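(* Let $R$ be a commutative ring with unity and let $M$ be a finitely generated faithful $R$-module with $\operatorname{Spec}(M)\neq\emptyset$. Then $\widetilde{\operatorname{Spec}(M)}$ is a compact space if and only if $R$ is a semi-local ring.
   Context: For a submodule $N$ of an $R$-module $M$, $(N:M)=\{r\in R : rM\subseteq N\}$. A proper submodule $P$ of $M$ is prime if whenever $rm\in P$ with $r\in R$, $m\in M$, then $m\in P$ or $r\in(P:M)$; in this case $(P:M)$ is a prime ideal of $R$. $\operatorname{Spec}(M)$ is the set of all prime submodules of $M$. A subset $T\subseteq R$ is multiplicatively closed if $1\in T$ and $xy\in T$ whenever $x,y\in T$. For a family $\mathcal{S}=\{S_i\}_{i\in I}$ of multiplicatively closed subsets of $R$, $\widetilde{V}(\mathcal{S})=\{P\in\operatorname{Spec}(M) \mid (P:M)\cap S_i\neq\emptyset \text{ for all } i\in I\}$. $\widetilde{\operatorname{Spec}(M)}$ denotes the set $\operatorname{Spec}(M)$ with the topology whose closed sets are exactly the sets $\widetilde{V}(\mathcal{S})$, $\mathcal{S}$ ranging over all families of multiplicatively closed subsets of $R$. Compact means quasi-compact: every open cover has a finite subcover (no Hausdorff condition). A ring is semi-local if it has only finitely many maximal ideals. *)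

theory Defs
  imports "HOL-Analysis.Abstract_Topology" "HOL-Algebra.Ideal" "HOL-Algebra.Module"
begin

definition finitely_generated_module ::
    "('a, 'r) ring_scheme \<Rightarrow> ('a, 'b, 'm) module_scheme \<Rightarrow> bool" where
  "finitely_generated_module R M \<longleftrightarrow>
     (\<exists>A. finite A \<and> A \<subseteq> carrier M \<and>
        carrier M = {(\<Oplus>\<^bsub>M\<^esub>a\<in>A. c a \<odot>\<^bsub>M\<^esub> a) | c. c \<in> A \<rightarrow> carrier R})"

definition faithful_module ::
    "('a, 'r) ring_scheme \<Rightarrow> ('a, 'b, 'm) module_scheme \<Rightarrow> bool" where
  "faithful_module R M \<longleftrightarrow>
     (\<forall>r\<in>carrier R. (\<forall>x\<in>carrier M. r \<odot>\<^bsub>M\<^esub> x = \<zero>\<^bsub>M\<^esub>) \<longrightarrow> r = \<zero>\<^bsub>R\<^esub>)"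

definition semi_local_ring :: "('a, 'r) ring_scheme \<Rightarrow> bool" where
  "semi_local_ring R \<longleftrightarrow> finite {I. maximalideal I R}"

definition residual ::
    "('a, 'r) ring_scheme \<Rightarrow> ('a, 'b, 'm) module_scheme \<Rightarrow> 'b set \<Rightarrow> 'a set" where
  "residual R M N = {r \<in> carrier R. \<forall>x\<in>carrier M. r \<odot>\<^bsub>M\<^esub> x \<in> N}"

definition prime_submodule ::
    "('a, 'r) ring_scheme \<Rightarrow> ('a, 'b, 'm) module_scheme \<Rightarrow> 'b set \<Rightarrow> bool" where
  "prime_submodule R M P \<longleftrightarrow>
     submodule P R M \<and> P \<noteq> carrier M \<and>
     (\<forall>r\<in>carrier R. \<forall>x\<in>carrier M.
        r \<odot>\<^bsub>M\<^esub> x \<in> P \<longrightarrow> x \<in> P \<or> r \<in> residual R M P)"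

definition module_spec ::
    "('a, 'r) ring_scheme \<Rightarrow> ('a, 'b, 'm) module_scheme \<Rightarrow> 'b set set" where
  "module_spec R M = {P. prime_submodule R M P}"

text \<open>A multiplicatively closed subset of \<open>R\<close> is a submonoid of the multiplicative monoid of
  \<open>R\<close>; it may contain zero. Families are given as sets of such subsets, since \<open>V_tilde\<close> depends
  only on which subsets occur in the family. The empty family is allowed and gives the whole
  spectrum.\<close>

definition V_tilde ::
    "('a, 'r) ring_scheme \<Rightarrow> ('a, 'b, 'm) module_scheme \<Rightarrow> 'a set set \<Rightarrow> 'b set set" where
  "V_tilde R M \<S> = {P \<in> module_spec R M. \<forall>S\<in>\<S>. residual R M P \<inter> S \<noteq> {}}"

definition spec_tilde ::
    "('a, 'r) ring_scheme \<Rightarrow> ('a, 'b, 'm) module_scheme \<Rightarrow> 'b set topology" where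
  "spec_tilde R M =
     topology (\<lambda>U. \<exists>\<S>. (\<forall>S\<in>\<S>. submonoid S R) \<and> U = module_spec R M - V_tilde R M \<S>)"

text \<open>The complements of the sets \<open>V_tilde R M \<S>\<close> do form a topology, so that
  \<open>spec_tilde\<close> is the intended one (\<open>closedin_spec_tilde\<close>).\<close>

context module
begin

lemma submonoid_compl_residual:
  assumes P: "prime_submodule R M P"
  shows "submonoid (carrier R - residual R M P) R"
proof
  have sub: "submodule P R M" and ne: "P \<noteq> carrier M"
    and pr: "\<And>r x. r \<in> carrier R \<Longrightarrow> x \<in> carrier M \<Longrightarrow> r \<odot>\<^bsub>M\<^esub> x \<in> P \<Longrightarrow>
               x \<in> P \<or> r \<in> residual R M P"
    using P by (auto simp: prime_submodule_def)
  show "carrier R - residual R M P \<subseteq> carrier R" by blast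
  show "\<one> \<in> carrier R - residual R M P"
    using ne submoduleE(1)[OF sub] by (auto simp: residual_def)
  fix r s
  assume r: "r \<in> carrier R - residual R M P" and s: "s \<in> carrier R - residual R M P"
  then obtain x where x: "x \<in> carrier M" "s \<odot>\<^bsub>M\<^esub> x \<notin> P"
    by (auto simp: residual_def)
  have "r \<odot>\<^bsub>M\<^esub> (s \<odot>\<^bsub>M\<^esub> x) \<notin> P"
    using pr[of r "s \<odot>\<^bsub>M\<^esub> x"] r s x by auto
  then have "(r \<otimes> s) \<odot>\<^bsub>M\<^esub> x \<notin> P"
    using r s x by (simp add: smult_assoc1)
  then show "r \<otimes> s \<in> carrier R - residual R M P"
    using r s x by (auto simp: residual_def)
qed

lemma V_tilde_Un:
  assumes S: "\<forall>S\<in>\<S>. submonoid S R" and T: "\<forall>T\<in>\<T>. submonoid T R"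
  shows "\<exists>\<X>. (\<forall>X\<in>\<X>. submonoid X R) \<and> V_tilde R M \<X> = V_tilde R M \<S> \<union> V_tilde R M \<T>"
proof (intro exI conjI)
  let ?V = "V_tilde R M \<S> \<union> V_tilde R M \<T>"
  let ?X = "{X. submonoid X R \<and> (\<forall>P\<in>?V. residual R M P \<inter> X \<noteq> {})}"
  show "\<forall>X\<in>?X. submonoid X R" by blast
  show "V_tilde R M ?X = ?V"
  proof
    show "?V \<subseteq> V_tilde R M ?X" by (auto simp: V_tilde_def)
    show "V_tilde R M ?X \<subseteq> ?V"
    proof (rule subsetI, rule ccontr)
      fix Q assume Q: "Q \<in> V_tilde R M ?X" and nQ: "Q \<notin> ?V"
      let ?C = "carrier R - residual R M Q"
      have Qs: "Q \<in> module_spec R M" using Q by (simp add: V_tilde_def)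
      obtain S where S': "S \<in> \<S>" "residual R M Q \<inter> S = {}"
        using nQ Qs by (auto simp: V_tilde_def)
      obtain T where T': "T \<in> \<T>" "residual R M Q \<inter> T = {}"
        using nQ Qs by (auto simp: V_tilde_def)
      have "S \<subseteq> ?C" "T \<subseteq> ?C"
        using S T S' T' submonoid.subset by blast+
      then have "residual R M P \<inter> ?C \<noteq> {}" if "P \<in> ?V" for P
        using that S'(1) T'(1) by (fastforce simp: V_tilde_def)
      moreover have "submonoid ?C R"
        using Qs submonoid_compl_residual by (simp add: module_spec_def)
      ultimately have "residual R M Q \<inter> ?C \<noteq> {}"
        using Q by (auto simp: V_tilde_def)
      then show False by blast
    qed
  qed
qed

lemma istopology_spec_tilde:
  "istopology (\<lambda>U. \<exists>\<S>. (\<forall>S\<in>\<S>. submonoid S R) \<and> U = module_spec R M - V_tilde R M \<S>)"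
    (is "istopology ?L")
  unfolding istopology_def
proof (intro conjI allI impI)
  fix U U' assume "?L U" and "?L U'"
  then obtain \<S> \<T> where
    "\<forall>S\<in>\<S>. submonoid S R" "U = module_spec R M - V_tilde R M \<S>"
    "\<forall>T\<in>\<T>. submonoid T R" "U' = module_spec R M - V_tilde R M \<T>"
    by blast
  with V_tilde_Un[of \<S> \<T>] show "?L (U \<inter> U')"
    by (metis Diff_Un)
next
  fix \<K> assume "\<forall>K\<in>\<K>. ?L K"
  then obtain F where F: "\<And>K. K \<in> \<K> \<Longrightarrow>
      (\<forall>S\<in>F K. submonoid S R) \<and> K = module_spec R M - V_tilde R M (F K)"
    by metis
  have "\<Union>\<K> = (\<Union>K\<in>\<K>. module_spec R M - V_tilde R M (F K))"
    using F by auto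
  also have "\<dots> = module_spec R M - V_tilde R M (\<Union>(F ` \<K>))"
    by (auto simp: V_tilde_def)
  finally show "?L (\<Union>\<K>)"
    using F by (intro exI[of _ "\<Union>(F ` \<K>)"]) blast
qed

lemma openin_spec_tilde:
  "openin (spec_tilde R M) U \<longleftrightarrow>
     (\<exists>\<S>. (\<forall>S\<in>\<S>. submonoid S R) \<and> U = module_spec R M - V_tilde R M \<S>)"
  unfolding spec_tilde_def topology_inverse'[OF istopology_spec_tilde] ..

lemma topspace_spec_tilde: "topspace (spec_tilde R M) = module_spec R M"
proof
  show "topspace (spec_tilde R M) \<subseteq> module_spec R M"
    by (auto simp: topspace_def openin_spec_tilde)
  have "residual R M P \<inter> {\<one>} = {}" if "P \<in> module_spec R M" for P
    using submonoid.one_closed[OF submonoid_compl_residual] that by (auto simp: module_spec_def)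
  then have "module_spec R M = module_spec R M - V_tilde R M {{\<one>}}"
    by (auto simp: V_tilde_def)
  moreover have "submonoid {\<one>} R" by unfold_locales auto
  ultimately have "openin (spec_tilde R M) (module_spec R M)"
    unfolding openin_spec_tilde by blast
  then show "module_spec R M \<subseteq> topspace (spec_tilde R M)"
    by (rule openin_subset)
qed

lemma closedin_spec_tilde:
  "closedin (spec_tilde R M) C \<longleftrightarrow> (\<exists>\<S>. (\<forall>S\<in>\<S>. submonoid S R) \<and> C = V_tilde R M \<S>)"
proof -
  have "V_tilde R M \<S> \<subseteq> module_spec R M" for \<S>
    by (auto simp: V_tilde_def)
  then show ?thesis
    unfolding closedin_def topspace_spec_tilde openin_spec_tilde by blast
qed

end

end

theory Submission
  imports Defs "HOL-Algebra.Ring_Divisibility"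
begin

text \<open>The residual \<open>(Q : M)\<close> alone decides which basic open sets contain \<open>Q\<close>, and the smallest
  open neighbourhood of \<open>P\<close> consists of the \<open>Q\<close> with \<open>(Q : M) \<subseteq> (P : M)\<close>. Hence the space is
  compact iff finitely many of the ideals \<open>(P : M)\<close> dominate all others. By a Nakayama argument every
  maximal ideal \<open>\<mm>\<close> of \<open>R\<close> is of the form \<open>(P : M)\<close>: as \<open>M\<close> is finitely generated and faithful,
  \<open>\<mm>M \<noteq> M\<close>. So the dominating ideals may be taken to be the maximal ones, and every dominating
  family contains all of them.\<close>

section \<open>Maximal ideals of the base ring\<close>

text \<open>Zorn's lemma on the ideals above \<open>I\<close>, with properness encoded as
  \<open>\<one> \<notin> J\<close>, a condition that survives unions of chains.\<close>

lemma (in ring) exists_maximalideal_superset: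
  assumes I: "ideal I R" and ne: "I \<noteq> carrier R"
  obtains J where "maximalideal J R" "I \<subseteq> J"
proof -
  let ?A = "{J. ideal J R \<and> I \<subseteq> J \<and> \<one> \<notin> J}"
  have "\<one> \<notin> I"
    using ideal.one_imp_carrier[OF I] ne by blast
  then have "?A \<noteq> {}"
    using I by blast
  moreover have "\<Union>C \<in> ?A" if C: "C \<noteq> {}" "subset.chain ?A C" for C
  proof -
    have "subset.chain {J. ideal J R} C" and CA: "C \<subseteq> ?A"
      using C(2) by (auto simp: subset_chain_def)
    then have "ideal (\<Union>C) R"
      using chain_Union_is_ideal[of C] C(1) by simp
    with C(1) CA show ?thesis
      by blast
  qed
  ultimately have "\<exists>J\<in>?A. \<forall>K\<in>?A. J \<subseteq> K \<longrightarrow> K = J"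
    by (rule subset_Zorn_nonempty)
  then obtain J where J: "J \<in> ?A" and max: "\<And>K. K \<in> ?A \<Longrightarrow> J \<subseteq> K \<Longrightarrow> K = J"
    by (elim bexE) blast
  have "maximalideal J R"
  proof (rule maximalidealI)
    show "ideal J R" "carrier R \<noteq> J"
      using J by auto
    fix K assume K: "ideal K R" "J \<subseteq> K" "K \<subseteq> carrier R"
    show "K = J \<or> K = carrier R"
      using max[of K] J K ideal.one_imp_carrier[OF K(1)] by blast
  qed
  with J that show ?thesis by blast
qed

text \<open>Maximality forces \<open>Rr + I = R\<close>, so 1 splits accordingly: \<open>r\<close>
  is invertible modulo \<open>I\<close>.\<close>

lemma (in cring) maximalideal_unit_modulo:
  assumes I: "maximalideal I R" and r: "r \<in> carrier R" "r \<notin> I"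
  obtains u j where "u \<in> carrier R" "j \<in> I" "\<one> = u \<otimes> r \<oplus> j"
proof -
  interpret maximalideal I R by fact
  have idl: "ideal (set_add R (PIdl r) I) R"
    using add_ideals cgenideal_ideal[OF r(1)] is_ideal by blast
  have "x \<in> set_add R (PIdl r) I" if "x \<in> I" for x
  proof -
    have "\<zero> \<otimes> r \<oplus> x \<in> set_add R (PIdl r) I"
      using that unfolding set_add_def' cgenideal_def by blast
    then show ?thesis using that r Icarr by simp
  qed
  moreover have "r \<in> set_add R (PIdl r) I"
  proof -
    have "\<one> \<otimes> r \<oplus> \<zero> \<in> set_add R (PIdl r) I"
      using zero_closed unfolding set_add_def' cgenideal_def by blast
    then show ?thesis using r by simp
  qed
  ultimately have "set_add R (PIdl r) I = carrier R"
    using I_maximal[OF idl] r additive_subgroup.a_subset[OF ideal.axioms(1)[OF idl]] by blast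
  then have "\<one> \<in> set_add R (PIdl r) I" by simp
  then show ?thesis
    using that unfolding set_add_def' cgenideal_def by blast
qed

section \<open>Submodules and their residual ideals\<close>

context module
begin

lemma submodule_zero: "submodule {\<zero>\<^bsub>M\<^esub>} R M"
  by (rule submoduleI) auto

lemma submodule_zero_mem: "submodule N R M \<Longrightarrow> \<zero>\<^bsub>M\<^esub> \<in> N"
  using submoduleE(1,2,4)[of N] by (metis R.zero_closed ex_in_conv smult_l_null subsetD)

lemma submodule_finsum_closed:
  assumes N: "submodule N R M" and fin: "finite A" and f: "f \<in> A \<rightarrow> N"
  shows "(\<Oplus>\<^bsub>M\<^esub>a\<in>A. f a) \<in> N"
  using fin f
proof (induction A)
  case empty
  then show ?case by (simp add: submodule_zero_mem[OF N])
next
  case (insert a A)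
  have "f \<in> A \<rightarrow> carrier M" "f a \<in> carrier M"
    using insert.prems submoduleE(1)[OF N] by auto
  then show ?case
    using insert submoduleE(5)[OF N] by (simp add: M.finsum_insert)
qed

lemma residual_subset: "residual R M N \<subseteq> carrier R"
  by (auto simp: residual_def)

lemma ideal_residual:
  assumes N: "submodule N R M"
  shows "ideal (residual R M N) R"
proof (rule idealI)
  show "ring R" by (rule R.ring_axioms)
  show "subgroup (residual R M N) (add_monoid R)"
    using submoduleE[OF N] submodule_zero_mem[OF N]
    by (intro R.add.subgroupI)
       (auto simp: residual_def smult_l_distr smult_l_minus simp flip: a_inv_def)
  fix r s assume "r \<in> residual R M N" "s \<in> carrier R"
  then show "s \<otimes> r \<in> residual R M N"
    using submoduleE(4)[OF N] by (auto simp: residual_def smult_assoc1)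
  then show "r \<otimes> s \<in> residual R M N"
    using \<open>r \<in> residual R M N\<close> \<open>s \<in> carrier R\<close> by (simp add: residual_def R.m_comm)
qed

lemma one_notin_residual:
  assumes "submodule N R M" "N \<noteq> carrier M"
  shows "\<one> \<notin> residual R M N"
  using assms submoduleE(1)[OF assms(1)] by (auto simp: residual_def)

section \<open>Nakayama's lemma for a prime ideal\<close>

text \<open>This is \<open>N + Ia\<close>. The Nakayama argument takes it both for
  \<open>I = carrier R\<close>, giving \<open>N + Ra\<close>, and for the prime ideal
  itself.\<close>

lemma submodule_add_multiples:
  assumes N: "submodule N R M" and I: "ideal I R" and a: "a \<in> carrier M"
  shows "submodule {n \<oplus>\<^bsub>M\<^esub> i \<odot>\<^bsub>M\<^esub> a | n i. n \<in> N \<and> i \<in> I} R M" (is "submodule ?K R M")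
proof -
  interpret I: ideal I R by fact
  note E = submoduleE[OF N]
  have Nc: "n \<in> carrier M" if "n \<in> N" for n using that E(1) by blast
  show ?thesis
  proof (rule submoduleI)
    show "?K \<subseteq> carrier M"
      using Nc a I.Icarr by auto
    have "\<zero>\<^bsub>M\<^esub> = \<zero>\<^bsub>M\<^esub> \<oplus>\<^bsub>M\<^esub> \<zero> \<odot>\<^bsub>M\<^esub> a"
      using a by simp
    then show "\<zero>\<^bsub>M\<^esub> \<in> ?K"
      using submodule_zero_mem[OF N] I.zero_closed by blast
  next
    fix x assume "x \<in> ?K"
    then obtain n i where x: "x = n \<oplus>\<^bsub>M\<^esub> i \<odot>\<^bsub>M\<^esub> a" "n \<in> N" "i \<in> I" by blast
    then have "\<ominus>\<^bsub>M\<^esub> x = \<ominus>\<^bsub>M\<^esub> n \<oplus>\<^bsub>M\<^esub> (\<ominus> i) \<odot>\<^bsub>M\<^esub> a"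
      using Nc a I.Icarr by (simp add: M.minus_add smult_l_minus)
    then show "\<ominus>\<^bsub>M\<^esub> x \<in> ?K"
      using x E(3) I.a_inv_closed by blast
  next
    fix x y assume "x \<in> ?K" "y \<in> ?K"
    then obtain n i n' i' where xy: "x = n \<oplus>\<^bsub>M\<^esub> i \<odot>\<^bsub>M\<^esub> a" "n \<in> N" "i \<in> I"
      "y = n' \<oplus>\<^bsub>M\<^esub> i' \<odot>\<^bsub>M\<^esub> a" "n' \<in> N" "i' \<in> I" by blast
    then have "x \<oplus>\<^bsub>M\<^esub> y = (n \<oplus>\<^bsub>M\<^esub> n') \<oplus>\<^bsub>M\<^esub> (i \<oplus> i') \<odot>\<^bsub>M\<^esub> a"
      using Nc a I.Icarr by (simp add: M.a_ac smult_l_distr)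
    then show "x \<oplus>\<^bsub>M\<^esub> y \<in> ?K"
      using xy E(5) I.a_closed by blast
  next
    fix r x assume r: "r \<in> carrier R" and "x \<in> ?K"
    then obtain n i where x: "x = n \<oplus>\<^bsub>M\<^esub> i \<odot>\<^bsub>M\<^esub> a" "n \<in> N" "i \<in> I" by blast
    then have "r \<odot>\<^bsub>M\<^esub> x = r \<odot>\<^bsub>M\<^esub> n \<oplus>\<^bsub>M\<^esub> (r \<otimes> i) \<odot>\<^bsub>M\<^esub> a"
      using r Nc a I.Icarr by (simp add: smult_r_distr smult_assoc1)
    then show "r \<odot>\<^bsub>M\<^esub> x \<in> ?K"
      using r x E(4) I.I_l_closed by blast
  qed
qed

text \<open>Multiplication by \<open>s\<close> is \<open>R\<close>-linear because \<open>R\<close>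
  is commutative. An inclusion \<open>sM \<subseteq> N\<close> can then be proved by showing that
  this preimage of \<open>N\<close> is all of \<open>M\<close>.\<close>

lemma submodule_vimage_smult:
  assumes N: "submodule N R M" and s: "s \<in> carrier R"
  shows "submodule {x \<in> carrier M. s \<odot>\<^bsub>M\<^esub> x \<in> N} R M"
proof (rule submoduleI)
  note E = submoduleE[OF N]
  fix r x assume r: "r \<in> carrier R" and x: "x \<in> {x \<in> carrier M. s \<odot>\<^bsub>M\<^esub> x \<in> N}"
  have "s \<odot>\<^bsub>M\<^esub> (r \<odot>\<^bsub>M\<^esub> x) = r \<odot>\<^bsub>M\<^esub> (s \<odot>\<^bsub>M\<^esub> x)"
    using r s x by (simp add: R.m_comm flip: smult_assoc1)
  then show "r \<odot>\<^bsub>M\<^esub> x \<in> {x \<in> carrier M. s \<odot>\<^bsub>M\<^esub> x \<in> N}"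
    using r x E(4) by simp
qed (use s submoduleE[OF N] submodule_zero_mem[OF N] in \<open>auto simp: smult_r_minus smult_r_distr\<close>)

text \<open>Nakayama's lemma for \<open>M / N\<close>, with \<open>M = N + IM\<close> and \<open>M = N + \<langle>A\<rangle>\<close> expressed by
  quantifying over submodules. Adjoining \<open>a\<close> to \<open>N\<close> gives \<open>sM \<subseteq> N + Ra\<close>, hence
  \<open>sM = sN + I(sM) \<subseteq> N + Ia\<close>; so \<open>sa \<in> N + ia\<close> for some \<open>i \<in> I\<close>, and \<open>s(s - i)\<close> maps \<open>M\<close>
  into \<open>N\<close>.\<close>

lemma nakayama_residual:
  assumes I: "primeideal I R"
    and "finite A" "A \<subseteq> carrier M"
    and "submodule N R M"
    and "\<And>K. submodule K R M \<Longrightarrow> N \<subseteq> K \<Longrightarrow> A \<subseteq> K \<Longrightarrow> K = carrier M"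
    and "\<And>K. submodule K R M \<Longrightarrow> N \<subseteq> K \<Longrightarrow> I \<subseteq> residual R M K \<Longrightarrow> K = carrier M"
  shows "\<exists>s \<in> residual R M N. s \<notin> I"
  using assms(2-)
proof (induction A arbitrary: N)
  case empty
  \<comment> \<open>Without generators, the generation hypothesis for \<open>K = N\<close> gives
    \<open>N = M\<close>, and 1 serves as \<open>s\<close>.\<close>
  then have "N = carrier M" by blast
  moreover have "\<one> \<notin> I"
    using I primeideal.I_notcarr ideal.one_imp_carrier primeideal.axioms(1) by blast
  ultimately show ?case
    by (auto simp: residual_def)
next
  case (insert a A)
  interpret I: primeideal I R by fact
  note N = insert.prems(2)
  note NE = submoduleE[OF N]
  have a: "a \<in> carrier M" and A: "A \<subseteq> carrier M" using insert.prems(1) by auto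
  have Nc: "n \<in> carrier M" if "n \<in> N" for n using that NE(1) by blast
  let ?N' = "{n \<oplus>\<^bsub>M\<^esub> r \<odot>\<^bsub>M\<^esub> a | n r. n \<in> N \<and> r \<in> carrier R}"
  let ?L = "{n \<oplus>\<^bsub>M\<^esub> i \<odot>\<^bsub>M\<^esub> a | n i. n \<in> N \<and> i \<in> I}"
  have N': "submodule ?N' R M"
    by (rule submodule_add_multiples[OF N R.oneideal a])
  have L: "submodule ?L R M"
    by (rule submodule_add_multiples[OF N I.is_ideal a])
  have NL: "N \<subseteq> ?L"
  proof
    fix n assume n: "n \<in> N"
    then have "n = n \<oplus>\<^bsub>M\<^esub> \<zero> \<odot>\<^bsub>M\<^esub> a" using a Nc by simp
    then show "n \<in> ?L" using n I.zero_closed by blast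
  qed
  also have "?L \<subseteq> ?N'" using I.Icarr by blast
  finally have NN': "N \<subseteq> ?N'" .
  have "a = \<zero>\<^bsub>M\<^esub> \<oplus>\<^bsub>M\<^esub> \<one> \<odot>\<^bsub>M\<^esub> a" using a by simp
  then have aN': "a \<in> ?N'" using submodule_zero_mem[OF N] R.one_closed by blast
  \<comment> \<open>Both hypotheses pass to the larger submodule \<open>?N' = N + Ra\<close>, which
    already contains \<open>a\<close>, so the generators in \<open>A\<close> suffice there.\<close>
  have "\<exists>s \<in> residual R M ?N'. s \<notin> I"
  proof (rule insert.IH[OF A N'])
    fix K assume K: "submodule K R M" "?N' \<subseteq> K"
    show "K = carrier M" if "A \<subseteq> K"
      using insert.prems(3)[OF K(1)] K(2) NN' aN' that by blast
    show "K = carrier M" if "I \<subseteq> residual R M K"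
      using insert.prems(4)[OF K(1)] K(2) NN' that by blast
  qed
  then obtain s where s: "s \<in> carrier R" "s \<notin> I"
    and sM: "\<And>x. x \<in> carrier M \<Longrightarrow> s \<odot>\<^bsub>M\<^esub> x \<in> ?N'"
    by (auto simp: residual_def)
  let ?K = "{x \<in> carrier M. s \<odot>\<^bsub>M\<^esub> x \<in> ?L}"
  \<comment> \<open>This sharpens \<open>sM \<subseteq> N + Ra\<close> to
    \<open>sM \<subseteq> N + Ia\<close>: for \<open>i\<close> in \<open>I\<close>,
    \<open>s(ix) = i(sx)\<close> lies in \<open>I(N + Ra)\<close>, hence in
    \<open>N + Ia\<close>.\<close>
  have "?K = carrier M"
  proof (rule insert.prems(4))
    show "submodule ?K R M" by (rule submodule_vimage_smult[OF L s(1)])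
    show "N \<subseteq> ?K" using NL NE(4) s(1) Nc by blast
    have "s \<odot>\<^bsub>M\<^esub> (i \<odot>\<^bsub>M\<^esub> x) \<in> ?L" if i: "i \<in> I" and x: "x \<in> carrier M" for i x
    proof -
      obtain n r where nr: "s \<odot>\<^bsub>M\<^esub> x = n \<oplus>\<^bsub>M\<^esub> r \<odot>\<^bsub>M\<^esub> a" "n \<in> N" "r \<in> carrier R"
        using sM[OF x] by blast
      have ic: "i \<in> carrier R" using i by (rule I.Icarr)
      have "s \<odot>\<^bsub>M\<^esub> (i \<odot>\<^bsub>M\<^esub> x) = i \<odot>\<^bsub>M\<^esub> (s \<odot>\<^bsub>M\<^esub> x)"
        using ic s x by (simp add: R.m_comm flip: smult_assoc1)
      also have "\<dots> = i \<odot>\<^bsub>M\<^esub> n \<oplus>\<^bsub>M\<^esub> (i \<otimes> r) \<odot>\<^bsub>M\<^esub> a"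
        using ic nr Nc a by (simp add: smult_r_distr smult_assoc1)
      finally show ?thesis
        using NE(4)[OF ic nr(2)] I.I_r_closed[OF i nr(3)] by blast
    qed
    then show "I \<subseteq> residual R M ?K"
      using I.Icarr by (auto simp: residual_def simp del: mem_Collect_eq intro!: CollectI)
  qed
  then have "a \<in> ?K" using a by simp
  then obtain n i where ni: "s \<odot>\<^bsub>M\<^esub> a = n \<oplus>\<^bsub>M\<^esub> i \<odot>\<^bsub>M\<^esub> a" "n \<in> N" "i \<in> I" by blast
  have ic: "i \<in> carrier R" using ni(3) by (rule I.Icarr)
  \<comment> \<open>From \<open>sa = n + ia\<close> it follows that \<open>t\<close> sends
    \<open>a\<close> into \<open>N\<close>, and \<open>t\<close> stays outside \<open>I\<close>
    because it is congruent to \<open>s\<close>.\<close>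
  define t where "t = s \<oplus> \<ominus> i"
  have t: "t \<in> carrier R" using s ic by (simp add: t_def)
  have "s = t \<oplus> i" using s ic by (simp add: t_def R.a_assoc R.l_neg)
  then have tI: "t \<notin> I" using s(2) I.a_closed[OF _ ni(3)] by blast
  have "t \<odot>\<^bsub>M\<^esub> a = n"
    using s ic ni a Nc by (simp add: t_def smult_l_distr smult_l_minus M.a_assoc M.r_neg)
  then have ta: "t \<odot>\<^bsub>M\<^esub> a \<in> N" using ni by simp
  \<comment> \<open>First \<open>s\<close> moves \<open>x\<close> into \<open>N + Ra\<close>, then
    \<open>t\<close> kills \<open>a\<close> modulo \<open>N\<close>.\<close>
  have "(t \<otimes> s) \<odot>\<^bsub>M\<^esub> x \<in> N" if x: "x \<in> carrier M" for x
  proof -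
    obtain m r where mr: "s \<odot>\<^bsub>M\<^esub> x = m \<oplus>\<^bsub>M\<^esub> r \<odot>\<^bsub>M\<^esub> a" "m \<in> N" "r \<in> carrier R"
      using sM[OF x] by blast
    have "(t \<otimes> s) \<odot>\<^bsub>M\<^esub> x = t \<odot>\<^bsub>M\<^esub> m \<oplus>\<^bsub>M\<^esub> (t \<otimes> r) \<odot>\<^bsub>M\<^esub> a"
      using t s x mr Nc a by (simp add: smult_assoc1 smult_r_distr)
    also have "(t \<otimes> r) \<odot>\<^bsub>M\<^esub> a = r \<odot>\<^bsub>M\<^esub> (t \<odot>\<^bsub>M\<^esub> a)"
      using t mr a by (simp add: R.m_comm flip: smult_assoc1)
    finally show ?thesis
      using NE(4,5) t ta mr by simp
  qed
  then have "t \<otimes> s \<in> residual R M N"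
    using t s by (simp add: residual_def)
  moreover have "t \<otimes> s \<notin> I"
    using I.I_prime[OF t s(1)] tI s(2) by blast
  ultimately show ?case by blast
qed

section \<open>Maximal ideals as residuals of prime submodules\<close>

text \<open>Any proper submodule \<open>P\<close> with \<open>I \<subseteq> (P : M)\<close> will do:
  maximality gives \<open>(P : M) = I\<close>, and \<open>P\<close> is prime because elements
  outside \<open>I\<close> are invertible modulo \<open>I\<close>.\<close>

lemma maximalideal_is_residual:
  assumes fg: "finitely_generated_module R M" and faithful: "faithful_module R M"
    and I: "maximalideal I R"
  obtains P where "P \<in> module_spec R M" "residual R M P = I"
proof -
  interpret I: maximalideal I R by fact
  have pI: "primeideal I R"
    using R.maximalideal_prime[OF I] .
  obtain A where A: "finite A" "A \<subseteq> carrier M"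
    and gen: "carrier M = {(\<Oplus>\<^bsub>M\<^esub>a\<in>A. c a \<odot>\<^bsub>M\<^esub> a) | c. c \<in> A \<rightarrow> carrier R}"
    using fg by (auto simp: finitely_generated_module_def)
  have span: "K = carrier M" if K: "submodule K R M" "A \<subseteq> K" for K
  proof
    show "K \<subseteq> carrier M" using submoduleE(1)[OF K(1)] .
    show "carrier M \<subseteq> K"
    proof
      fix x assume "x \<in> carrier M"
      then obtain c where c: "x = (\<Oplus>\<^bsub>M\<^esub>a\<in>A. c a \<odot>\<^bsub>M\<^esub> a)" "c \<in> A \<rightarrow> carrier R"
        using gen by auto
      have "(\<lambda>a. c a \<odot>\<^bsub>M\<^esub> a) \<in> A \<rightarrow> K"
        using c(2) K(2) submoduleE(4)[OF K(1)] by blast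
      then show "x \<in> K"
        using c(1) submodule_finsum_closed[OF K(1) A(1)] by simp
    qed
  qed
  \<comment> \<open>By faithfulness no \<open>s\<close> outside \<open>I\<close> annihilates
    \<open>M\<close>. Nakayama's lemma for \<open>N = 0\<close> therefore fails in its last
    hypothesis, and the failure yields \<open>P\<close>.\<close>
  have "residual R M {\<zero>\<^bsub>M\<^esub>} \<subseteq> I"
    using faithful I.zero_closed by (auto simp: residual_def faithful_module_def)
  then obtain P where P: "submodule P R M" "I \<subseteq> residual R M P" "P \<noteq> carrier M"
    using nakayama_residual[OF pI A submodule_zero span] by blast
  have res: "residual R M P = I"
    using I.I_maximal[OF ideal_residual[OF P(1)] P(2) residual_subset]
      one_notin_residual[OF P(1,3)] R.one_closed by blast
  have "x \<in> P" if r: "r \<in> carrier R" "r \<notin> I" and x: "x \<in> carrier M" "r \<odot>\<^bsub>M\<^esub> x \<in> P" for r x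
  proof -
    obtain u j where uj: "u \<in> carrier R" "j \<in> I" "\<one> = u \<otimes> r \<oplus> j"
      using R.maximalideal_unit_modulo[OF I r] .
    have "x = (u \<otimes> r \<oplus> j) \<odot>\<^bsub>M\<^esub> x"
      using x uj(3) by (simp flip: uj(3))
    also have "\<dots> = u \<odot>\<^bsub>M\<^esub> (r \<odot>\<^bsub>M\<^esub> x) \<oplus>\<^bsub>M\<^esub> j \<odot>\<^bsub>M\<^esub> x"
      using r x uj I.Icarr by (simp add: smult_l_distr smult_assoc1)
    also have "\<dots> \<in> P"
      using submoduleE(4,5)[OF P(1)] uj x P(2) by (auto simp: residual_def)
    finally show ?thesis .
  qed
  then have "P \<in> module_spec R M"
    using P res by (auto simp: module_spec_def prime_submodule_def)
  with res that show ?thesis by blast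
qed

section \<open>Smallest neighbourhoods and compactness\<close>

text \<open>Meeting every \<open>S\<close> of a family is preserved when the residual grows, so
  closed sets are closed upwards and open sets downwards.\<close>

lemma openin_spec_tilde_downward:
  assumes "openin (spec_tilde R M) U" "P \<in> U" "Q \<in> module_spec R M"
    and "residual R M Q \<subseteq> residual R M P"
  shows "Q \<in> U"
  using assms unfolding openin_spec_tilde V_tilde_def by blast

text \<open>The complement of \<open>(P : M)\<close> is multiplicatively closed, and
  \<open>(Q : M)\<close> misses it exactly when \<open>(Q : M) \<subseteq> (P : M)\<close>.\<close>

lemma openin_spec_tilde_smallest:
  assumes "P \<in> module_spec R M"
  shows "openin (spec_tilde R M) {Q \<in> module_spec R M. residual R M Q \<subseteq> residual R M P}"
  unfolding openin_spec_tilde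
proof (intro exI conjI)
  show "\<forall>S\<in>{carrier R - residual R M P}. submonoid S R"
    using assms submonoid_compl_residual by (simp add: module_spec_def)
  show "{Q \<in> module_spec R M. residual R M Q \<subseteq> residual R M P} =
      module_spec R M - V_tilde R M {carrier R - residual R M P}"
    by (auto simp: V_tilde_def residual_def)
qed

text \<open>Compactness is tested on the cover by smallest neighbourhoods. Conversely, a cover
  member containing \<open>P\<close> contains the smallest neighbourhood of \<open>P\<close>, so one
  member for each \<open>P\<close> in \<open>F\<close> suffices.\<close>

lemma compact_space_spec_tilde_iff:
  "compact_space (spec_tilde R M) \<longleftrightarrow>
    (\<exists>F. finite F \<and> F \<subseteq> module_spec R M \<and>
      (\<forall>Q\<in>module_spec R M. \<exists>P\<in>F. residual R M Q \<subseteq> residual R M P))" (is "?C \<longleftrightarrow> ?D")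
proof
  assume C: ?C
  let ?B = "\<lambda>P. {Q \<in> module_spec R M. residual R M Q \<subseteq> residual R M P}"
  have "\<exists>\<F>. finite \<F> \<and> \<F> \<subseteq> ?B ` module_spec R M \<and> module_spec R M \<subseteq> \<Union>\<F>"
    using C[unfolded compact_space_alt topspace_spec_tilde, rule_format,
        of "?B ` module_spec R M"] openin_spec_tilde_smallest by blast
  then obtain F where F: "finite F" "F \<subseteq> module_spec R M" "module_spec R M \<subseteq> \<Union>(?B ` F)"
    by (metis (no_types, lifting) finite_subset_image)
  then show ?D
    by (intro exI[of _ F]) blast
next
  assume ?D
  then obtain F where F: "finite F" "F \<subseteq> module_spec R M"
    "\<And>Q. Q \<in> module_spec R M \<Longrightarrow> \<exists>P\<in>F. residual R M Q \<subseteq> residual R M P" by blast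
  show ?C
    unfolding compact_space_alt topspace_spec_tilde
  proof (intro allI impI, elim conjE)
    fix \<U> assume op: "\<forall>U\<in>\<U>. openin (spec_tilde R M) U" and cover: "module_spec R M \<subseteq> \<Union>\<U>"
    have "\<forall>P\<in>F. \<exists>U\<in>\<U>. P \<in> U" using F(2) cover by blast
    then obtain g where g: "\<And>P. P \<in> F \<Longrightarrow> g P \<in> \<U> \<and> P \<in> g P" by metis
    have "module_spec R M \<subseteq> \<Union>(g ` F)"
    proof
      fix Q assume Q: "Q \<in> module_spec R M"
      then obtain P where P: "P \<in> F" "residual R M Q \<subseteq> residual R M P"
        using F(3) by blast
      then have "Q \<in> g P"
        using openin_spec_tilde_downward[of "g P" P Q] g op Q by blast
      with P show "Q \<in> \<Union>(g ` F)" by blast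
    qed
    then show "\<exists>\<F>. finite \<F> \<and> \<F> \<subseteq> \<U> \<and> module_spec R M \<subseteq> \<Union>\<F>"
      using F(1) g by (intro exI[of _ "g ` F"]) auto
  qed
qed

end

theorem theorem13:
  fixes R :: "('a, 'r) ring_scheme" and M :: "('a, 'b, 'm) module_scheme"
  assumes "module R M"
    and "finitely_generated_module R M"
    and "faithful_module R M"
    and "module_spec R M \<noteq> {}"
  shows "compact_space (spec_tilde R M) \<longleftrightarrow> semi_local_ring R"
proof -
  interpret module R M by fact
  let ?Max = "{I. maximalideal I R}"
  have "\<forall>I\<in>?Max. \<exists>P. P \<in> module_spec R M \<and> residual R M P = I"
    using maximalideal_is_residual[OF assms(2,3)] by blast
  from bchoice[OF this] obtain p
    where "\<forall>I\<in>?Max. p I \<in> module_spec R M \<and> residual R M (p I) = I" ..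
  note p = bspec[OF this]
  have idl: "ideal (residual R M P) R" and proper: "residual R M P \<noteq> carrier R"
    if "P \<in> module_spec R M" for P
    using that ideal_residual[of P] one_notin_residual[of P] R.one_closed
    unfolding module_spec_def prime_submodule_def by auto
  have "semi_local_ring R" if "compact_space (spec_tilde R M)"
  proof -
    from that obtain F where F: "finite F" "F \<subseteq> module_spec R M"
      "\<And>Q. Q \<in> module_spec R M \<Longrightarrow> \<exists>P\<in>F. residual R M Q \<subseteq> residual R M P"
      unfolding compact_space_spec_tilde_iff by blast
    \<comment> \<open>Domination is applied to \<open>p I\<close>: the dominating residual is proper
      and contains \<open>I\<close>, hence equals it.\<close>
    have "I \<in> residual R M ` F" if I: "I \<in> ?Max" for I
    proof -
      obtain P where P: "P \<in> F" "I \<subseteq> residual R M P"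
        using F(3)[of "p I"] p[OF I] by auto
      have Ps: "P \<in> module_spec R M" using P F(2) by blast
      have "maximalideal I R" using I by simp
      then have "residual R M P = I"
        using maximalideal.I_maximal[OF _ idl[OF Ps] P(2) residual_subset] proper[OF Ps] by blast
      with P show ?thesis by blast
    qed
    then have "?Max \<subseteq> residual R M ` F" by (rule subsetI)
    then show ?thesis
      unfolding semi_local_ring_def by (rule finite_subset) (rule finite_imageI[OF F(1)])
  qed
  moreover have "compact_space (spec_tilde R M)" if "semi_local_ring R"
    unfolding compact_space_spec_tilde_iff
  \<comment> \<open>The dominating family is \<open>p\<close> applied to all maximal ideals, since
    each proper ideal \<open>(Q : M)\<close> lies in some maximal
    \<open>J = (p J : M)\<close>.\<close>
  proof (intro exI conjI ballI)
    show "finite (p ` ?Max)" using that by (simp add: semi_local_ring_def)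
    show "p ` ?Max \<subseteq> module_spec R M" using p by blast
    fix Q assume "Q \<in> module_spec R M"
    then obtain J where "maximalideal J R" "residual R M Q \<subseteq> J"
      using R.exists_maximalideal_superset[OF idl proper] by blast
    then show "\<exists>P\<in>p ` ?Max. residual R M Q \<subseteq> residual R M P"
      using p[of J] by auto
  qed
  ultimately show ?thesis by blast
qed

end
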